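(* We have $(\Phi(0,0),\Phi(0,1))=(0,1)$ and $(\Phi(1,0),\Phi(1,1),\Phi(1,2))=(0,2,2)$. For all integers $n \geq 2$ and $m \in \{0,\ldots,2^n\}$, \[ \Phi(n,m) = \begin{cases} 2\Phi(n-2,m)+m & \text{if } m \in \{0,\ldots,2^{n-2}\},\\ 2^n-s & \text{if } m \in \{2^{n-2}+1,\ldots,2^n\}, \end{cases} \] where $s$ is the greatest element of $\{0,\ldots,2^{n-2}\}$ such that $\Phi(n,s) \leq 2^n-m$.
   Context: For a nonnegative integer $n$, $[n]=\{1,\ldots,n\}$ (so $[0]=\emptyset$), and $2^X$ denotes the power set of a set $X$. For a family $\mathcal{F}$ of subsets of $[n]$, let $\mathcal{F}^{\downarrow}=\{S \subseteq [n]: S \subseteq F \text{ for some } F \in \mathcal{F}\}$, $\mathcal{F}^{\uparrow}=\{S \subseteq [n]: F \subseteq S \text{ for some } F \in \mathcal{F}\}$ and $\mathcal{F}^{\updownarrow}=\mathcal{F}^{\uparrow}\cup\mathcal{F}^{\downarrow}$. For nonnegative integers $m,n$ with $m \leq 2^n$, let $\Phi(n,m)=\min\{|\mathcal{F}^{\updownarrow}|: \mathcal{F}\subseteq 2^{[n]},\ |\mathcal{F}|=m\}$. *)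

theory Defs
  imports Main
begin

text \<open>The closures are taken inside the power set of \<open>{1..n}\<close>, so they carry the ground-set size \<open>n\<close>.\<close>

definition down_closure :: "nat \<Rightarrow> nat set set \<Rightarrow> nat set set" where
  "down_closure n \<F> = {S. S \<subseteq> {1..n} \<and> (\<exists>F\<in>\<F>. S \<subseteq> F)}"

definition up_closure :: "nat \<Rightarrow> nat set set \<Rightarrow> nat set set" where
  "up_closure n \<F> = {S. S \<subseteq> {1..n} \<and> (\<exists>F\<in>\<F>. F \<subseteq> S)}"

definition updown_closure :: "nat \<Rightarrow> nat set set \<Rightarrow> nat set set" where
  "updown_closure n \<F> = up_closure n \<F> \<union> down_closure n \<F>"

text \<open>Meaningful only for \<open>m \<le> 2 ^ n\<close>; otherwise the minimum is over the empty set.\<close>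

definition Phi :: "nat \<Rightarrow> nat \<Rightarrow> nat" where
  "Phi n m = Min {card (updown_closure n \<F>) |\<F>. \<F> \<subseteq> Pow {1..n} \<and> card \<F> = m}"

end

theory Submission
  imports Defs
begin

text \<open>
  For a family \<open>F\<close> of \<open>m\<close> sets let \<open>U\<close> and \<open>D\<close> be its up- and down-closure. Then
  \<open>F \<subseteq> U \<inter> D\<close> and the updown-closure is \<open>U \<union> D\<close>; conversely, any \<open>m\<close> members of
  \<open>U \<inter> D\<close>, for an up-set \<open>U\<close> and a down-set \<open>D\<close>, have their updown-closure inside
  \<open>U \<union> D\<close>. So \<open>Phi n m\<close> is the least \<open>|U \<union> D|\<close> subject to \<open>|U \<inter> D| \<ge> m\<close>, and since
  \<open>|U \<union> D| = |U| + |D| - |U \<inter> D|\<close> it is determined once the largest possible \<open>|U \<inter> D|\<close>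
  is known for every pair of sizes \<open>|U| = x\<close>, \<open>|D| = y\<close>.

  That maximum is attained by two lexicographic segments whose orders rank the coordinates in
  opposite ways: \<open>n\<close> is the most significant coordinate for \<open>U\<close> and \<open>1\<close> for \<open>D\<close>. This makes
  \<open>U\<close> and \<open>D\<close> nearly independent, and independence is the ideal, since every up-set and down-set
  satisfy the correlation inequality \<open>|U \<inter> D| \<le> xy / 2^n\<close>. The size of the intersection of the
  two segments is \<open>overlap n x y\<close>.
  Optimality (\<open>card_up_Int_down_le_overlap\<close>) is an induction on \<open>n\<close> that splits \<open>U\<close> and \<open>D\<close>
  along the last coordinate; everything there reduces to the superadditivity
  \<open>overlap n x0 y0 + overlap n x1 y1 \<le> overlap (n + 1) (x0 + x1) (y0 + y1)\<close> for
  \<open>x0 \<le> x1\<close>, \<open>y1 \<le> y0\<close> (\<open>overlap_superadd\<close>), a purely numerical fact.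

  The recursion for \<open>Phi\<close> is then read off from \<open>overlap\<close>. Passing from \<open>(U, D)\<close> to the
  complementary families exchanges \<open>|U \<inter> D|\<close> with \<open>2^n - |U \<union> D|\<close>, whence
  \<open>Phi n m \<le> k\<close> implies \<open>Phi n (2^n - k) \<le> 2^n - m\<close>; together with the correlation bound,
  which prevents \<open>|U \<inter> D|\<close> and \<open>2^n - |U \<union> D|\<close> from both exceeding a quarter of the cube,
  this gives the case \<open>m > 2^(n-2)\<close>. For \<open>m \<le> 2^(n-2)\<close> the point is that
  \<open>overlap n x y = overlap (n - 2) (x div 2) (y div 2)\<close> as long as \<open>x\<close> and \<open>y\<close> are at most half
  of the cube (\<open>overlap_halve\<close>), so an optimal pair on \<open>n\<close> coordinates corresponds to one of half
  the sizes on \<open>n - 2\<close> coordinates.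
\<close>

section \<open>Gluing families along a new coordinate\<close>

text \<open>The family on \<open>{1..n + 1}\<close> whose sections at \<open>n + 1\<close> are \<open>A\<close> (element absent) and \<open>B\<close>
  (element present).\<close>

definition glue :: "nat \<Rightarrow> nat set set \<Rightarrow> nat set set \<Rightarrow> nat set set" where
  "glue n A B = A \<union> insert (Suc n) ` B"

lemma glue_mono: "A \<subseteq> A' \<Longrightarrow> B \<subseteq> B' \<Longrightarrow> glue n A B \<subseteq> glue n A' B'"
  unfolding glue_def by blast

lemma glue_subset_Pow:
  assumes "A \<subseteq> Pow {1..n}" "B \<subseteq> Pow {1..n}"
  shows "glue n A B \<subseteq> Pow {1..Suc n}"
  using assms unfolding glue_def by (auto simp: subset_iff) (metis le_SucI, metis le_SucI)

lemma Suc_notin_if_Pow: "A \<subseteq> Pow {1..n} \<Longrightarrow> S \<in> A \<Longrightarrow> Suc n \<notin> S"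
  by (auto simp: subset_iff) (metis Suc_n_not_le_n)

lemma mem_glue_iff:
  assumes "A \<subseteq> Pow {1..n}" "B \<subseteq> Pow {1..n}"
  shows "S \<in> glue n A B \<longleftrightarrow> (if Suc n \<in> S then S - {Suc n} \<in> B else S \<in> A)"
proof (cases "Suc n \<in> S")
  case True
  have "S \<in> insert (Suc n) ` B \<longleftrightarrow> S - {Suc n} \<in> B"
  proof
    assume "S \<in> insert (Suc n) ` B"
    then obtain T where T: "T \<in> B" "S = insert (Suc n) T" by blast
    with Suc_notin_if_Pow[OF assms(2)] show "S - {Suc n} \<in> B" by auto
  next
    assume "S - {Suc n} \<in> B"
    with True show "S \<in> insert (Suc n) ` B" by (metis image_eqI insert_Diff)
  qed
  with True Suc_notin_if_Pow[OF assms(1)] show ?thesis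
    unfolding glue_def by auto
next
  case False
  then show ?thesis unfolding glue_def by auto
qed

lemma card_glue:
  assumes "A \<subseteq> Pow {1..n}" "B \<subseteq> Pow {1..n}"
  shows "card (glue n A B) = card A + card B"
proof -
  have fin: "finite A" "finite B"
    using assms by (meson finite_Pow_iff finite_atLeastAtMost finite_subset)+
  have "inj_on (insert (Suc n)) B"
    using Suc_notin_if_Pow[OF assms(2)] by (metis inj_onI insert_ident)
  then have "card (insert (Suc n) ` B) = card B" by (rule card_image)
  moreover have "A \<inter> insert (Suc n) ` B = {}"
    using Suc_notin_if_Pow[OF assms(1)] by blast
  ultimately show ?thesis
    unfolding glue_def using fin by (simp add: card_Un_disjoint)
qed

lemma glue_Int:
  assumes "A \<subseteq> Pow {1..n}" "B \<subseteq> Pow {1..n}" "C \<subseteq> Pow {1..n}" "D \<subseteq> Pow {1..n}"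
  shows "glue n A B \<inter> glue n C D = glue n (A \<inter> C) (B \<inter> D)"
proof -
  have "A \<inter> C \<subseteq> Pow {1..n}" "B \<inter> D \<subseteq> Pow {1..n}" using assms by blast+
  then show ?thesis
    unfolding set_eq_iff Int_iff mem_glue_iff[OF assms(1,2)] mem_glue_iff[OF assms(3,4)]
    by (simp add: mem_glue_iff)
qed

text \<open>Together with \<open>card_glue\<close> and \<open>glue_Int\<close> this lets inductions on \<open>n\<close> replace a family by
  its two sections.\<close>

lemma glue_sections:
  assumes "F \<subseteq> Pow {1..Suc n}"
  shows "F = glue n {S \<in> Pow {1..n}. S \<in> F} {S \<in> Pow {1..n}. insert (Suc n) S \<in> F}"
    (is "F = glue n ?A ?B")
proof (rule set_eqI)
  fix S
  have sub: "?A \<subseteq> Pow {1..n}" "?B \<subseteq> Pow {1..n}" by blast+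
  have "S \<in> F \<Longrightarrow> S - {Suc n} \<subseteq> {1..n}"
    using assms by (auto simp: atLeastAtMostSuc_conv)
  moreover have "Suc n \<in> S \<Longrightarrow> insert (Suc n) (S - {Suc n}) = S" by blast
  ultimately show "S \<in> F \<longleftrightarrow> S \<in> glue n ?A ?B"
    unfolding mem_glue_iff[OF sub] by (auto simp del: insert_Diff_single)
qed

section \<open>Up-sets and down-sets\<close>

definition up_set :: "nat \<Rightarrow> nat set set \<Rightarrow> bool" where
  "up_set n U \<longleftrightarrow> U \<subseteq> Pow {1..n} \<and> (\<forall>S\<in>U. \<forall>T. S \<subseteq> T \<longrightarrow> T \<subseteq> {1..n} \<longrightarrow> T \<in> U)"

definition down_set :: "nat \<Rightarrow> nat set set \<Rightarrow> bool" where
  "down_set n D \<longleftrightarrow> D \<subseteq> Pow {1..n} \<and> (\<forall>S\<in>D. \<forall>T. T \<subseteq> S \<longrightarrow> T \<in> D)"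

lemma Diff_Suc_subset: "T \<subseteq> {1..Suc n} \<Longrightarrow> T - {Suc n} \<subseteq> {1..n}"
  by (auto simp: atLeastAtMostSuc_conv)

lemma up_set_glue:
  assumes A: "up_set n A" and B: "up_set n B" and "A \<subseteq> B"
  shows "up_set (Suc n) (glue n A B)"
proof -
  have sub: "A \<subseteq> Pow {1..n}" "B \<subseteq> Pow {1..n}" using A B by (auto simp: up_set_def)
  have "T \<in> glue n A B" if S: "S \<in> glue n A B" and ST: "S \<subseteq> T" and T: "T \<subseteq> {1..Suc n}" for S T
  proof -
    have le: "S - {Suc n} \<subseteq> T - {Suc n}" "T - {Suc n} \<subseteq> {1..n}"
      using ST Diff_Suc_subset[OF T] by auto
    show ?thesis
    proof (cases "Suc n \<in> T")
      case True
      have "S - {Suc n} \<in> B"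
        using S \<open>A \<subseteq> B\<close> by (cases "Suc n \<in> S") (auto simp: mem_glue_iff[OF sub])
      with le B True show ?thesis by (auto simp: mem_glue_iff[OF sub] up_set_def)
    next
      case False
      with S ST have "S \<in> A" by (auto simp: mem_glue_iff[OF sub] split: if_splits)
      with False le ST A show ?thesis by (auto simp: mem_glue_iff[OF sub] up_set_def)
    qed
  qed
  with glue_subset_Pow[OF sub] show ?thesis unfolding up_set_def by blast
qed

lemma down_set_glue:
  assumes A: "down_set n A" and B: "down_set n B" and "B \<subseteq> A"
  shows "down_set (Suc n) (glue n A B)"
proof -
  have sub: "A \<subseteq> Pow {1..n}" "B \<subseteq> Pow {1..n}" using A B by (auto simp: down_set_def)
  have "T \<in> glue n A B" if S: "S \<in> glue n A B" and ST: "T \<subseteq> S" for S T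
  proof -
    have le: "T - {Suc n} \<subseteq> S - {Suc n}" using ST by auto
    show ?thesis
    proof (cases "Suc n \<in> T")
      case True
      with S ST have "S - {Suc n} \<in> B" by (auto simp: mem_glue_iff[OF sub] split: if_splits)
      with le B True show ?thesis by (auto simp: mem_glue_iff[OF sub] down_set_def)
    next
      case False
      have "S - {Suc n} \<in> A"
        using S \<open>B \<subseteq> A\<close> by (cases "Suc n \<in> S") (auto simp: mem_glue_iff[OF sub])
      with False le A have "T - {Suc n} \<in> A" unfolding down_set_def by blast
      with False show ?thesis by (simp add: mem_glue_iff[OF sub])
    qed
  qed
  with glue_subset_Pow[OF sub] show ?thesis unfolding down_set_def by blast
qed

lemma up_set_sections:
  assumes U: "up_set (Suc n) U"
  obtains A B where "up_set n A" "up_set n B" "A \<subseteq> B" "U = glue n A B"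
proof -
  define A where A: "A = {S \<in> Pow {1..n}. S \<in> U}"
  define B where B: "B = {S \<in> Pow {1..n}. insert (Suc n) S \<in> U}"
  have eq: "U = glue n A B"
    unfolding A B using U by (intro glue_sections) (simp add: up_set_def)
  have up: "T \<in> U" if "S \<in> U" "S \<subseteq> T" "T \<subseteq> {1..Suc n}" for S T
    using U that unfolding up_set_def by blast
  have sub: "S \<subseteq> {1..Suc n}" "insert (Suc n) S \<subseteq> {1..Suc n}" if "S \<subseteq> {1..n}" for S
    using that by (auto simp: subset_iff le_SucI)
  have "up_set n A" unfolding up_set_def A using up sub(1) by auto
  moreover have "up_set n B"
    unfolding up_set_def
  proof (intro conjI ballI allI impI)
    fix S T assume S: "S \<in> B" and ST: "S \<subseteq> T" and T: "T \<subseteq> {1..n}"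
    have "insert (Suc n) T \<in> U"
      using up[OF _ insert_mono[OF ST] sub(2)[OF T]] S by (simp add: B)
    with T show "T \<in> B" by (simp add: B)
  qed (auto simp: B)
  moreover have "A \<subseteq> B"
  proof
    fix S assume "S \<in> A"
    with A up[of S "insert (Suc n) S"] sub(2)[of S] show "S \<in> B" unfolding B by blast
  qed
  ultimately show ?thesis using that eq by blast
qed

lemma down_set_sections:
  assumes D: "down_set (Suc n) D"
  obtains A B where "down_set n A" "down_set n B" "B \<subseteq> A" "D = glue n A B"
proof -
  define A where A: "A = {S \<in> Pow {1..n}. S \<in> D}"
  define B where B: "B = {S \<in> Pow {1..n}. insert (Suc n) S \<in> D}"
  have eq: "D = glue n A B"
    unfolding A B using D by (intro glue_sections) (simp add: down_set_def)
  have down: "T \<in> D" if "S \<in> D" "T \<subseteq> S" for S T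
    using D that unfolding down_set_def by blast
  have "down_set n A" unfolding down_set_def A using down by auto
  moreover have "down_set n B"
    unfolding down_set_def
  proof (intro conjI ballI allI impI)
    fix S T assume S: "S \<in> B" and TS: "T \<subseteq> S"
    have "insert (Suc n) T \<in> D"
      using down[OF _ insert_mono[OF TS]] S by (simp add: B)
    with S TS show "T \<in> B" by (auto simp: B)
  qed (auto simp: B)
  moreover have "B \<subseteq> A"
    unfolding A B using down by blast
  ultimately show ?thesis using that eq by blast
qed

section \<open>Lexicographic up-sets and down-sets\<close>

text \<open>
  For \<open>x \<le> 2^n\<close>, \<open>lex_up n x\<close> consists of the \<open>x\<close> largest subsets in the lexicographic order in which \<open>n\<close> is the
  most significant element: the sets containing the new element are used up first.
\<close>

fun lex_up :: "nat \<Rightarrow> nat \<Rightarrow> nat set set" where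
  "lex_up 0 x = (if x = 0 then {} else {{}})"
| "lex_up (Suc n) x = glue n (lex_up n (x - 2 ^ n)) (lex_up n (min x (2 ^ n)))"

text \<open>
  For \<open>y \<le> 2^n\<close>, \<open>lex_down n y\<close> consists of the \<open>y\<close> smallest subsets in the opposite order, with \<open>1\<close> most
  significant: the new element is the least significant one, so the segment alternates between
  sets without it and sets with it, starting without.
\<close>

fun lex_down :: "nat \<Rightarrow> nat \<Rightarrow> nat set set" where
  "lex_down 0 y = (if y = 0 then {} else {{}})"
| "lex_down (Suc n) y = glue n (lex_down n ((y + 1) div 2)) (lex_down n (y div 2))"

lemma lex_up_mono: "x \<le> x' \<Longrightarrow> lex_up n x \<subseteq> lex_up n x'"
proof (induction n arbitrary: x x')
  case (Suc n)
  then have "x - 2 ^ n \<le> x' - 2 ^ n" "min x (2 ^ n) \<le> min x' (2 ^ n)" by auto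
  with Suc.IH show ?case by (simp add: glue_mono)
qed auto

lemma lex_down_mono: "y \<le> y' \<Longrightarrow> lex_down n y \<subseteq> lex_down n y'"
proof (induction n arbitrary: y y')
  case (Suc n)
  then have "(y + 1) div 2 \<le> (y' + 1) div 2" "y div 2 \<le> y' div 2" by auto
  with Suc.IH show ?case by (simp add: glue_mono)
qed auto

lemma up_set_lex_up: "x \<le> 2 ^ n \<Longrightarrow> up_set n (lex_up n x)"
proof (induction n arbitrary: x)
  case 0
  show ?case by (auto simp: up_set_def)
next
  case (Suc n)
  have "lex_up n (x - 2 ^ n) \<subseteq> lex_up n (min x (2 ^ n))"
    using Suc.prems by (intro lex_up_mono) auto
  moreover have "x - 2 ^ n \<le> 2 ^ n" using Suc.prems by simp
  ultimately show ?case using Suc.IH by (simp add: up_set_glue)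
qed

lemma down_set_lex_down: "down_set n (lex_down n y)"
proof (induction n arbitrary: y)
  case 0
  show ?case by (auto simp: down_set_def)
next
  case (Suc n)
  have "lex_down n (y div 2) \<subseteq> lex_down n ((y + 1) div 2)"
    by (intro lex_down_mono) auto
  with Suc show ?case by (simp add: down_set_glue)
qed

lemma lex_up_subset_Pow: "lex_up n x \<subseteq> Pow {1..n}"
proof (induction n arbitrary: x)
  case (Suc n)
  then show ?case unfolding lex_up.simps by (intro glue_subset_Pow)
qed simp

lemma lex_down_subset_Pow: "lex_down n y \<subseteq> Pow {1..n}"
  using down_set_lex_down by (simp add: down_set_def)

lemma card_lex_up: "x \<le> 2 ^ n \<Longrightarrow> card (lex_up n x) = x"
proof (induction n arbitrary: x)
  case (Suc n)
  have "card (lex_up n (x - 2 ^ n)) = x - 2 ^ n"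
    using Suc.prems by (intro Suc.IH) simp
  moreover have "card (lex_up n (min x (2 ^ n))) = min x (2 ^ n)"
    by (intro Suc.IH) simp
  ultimately show ?case using Suc.prems by (simp add: card_glue lex_up_subset_Pow del: One_nat_def)
qed simp

lemma card_lex_down: "y \<le> 2 ^ n \<Longrightarrow> card (lex_down n y) = y"
proof (induction n arbitrary: y)
  case (Suc n)
  have "card (lex_down n ((y + 1) div 2)) = (y + 1) div 2"
    using Suc.prems by (intro Suc.IH) simp
  moreover have "card (lex_down n (y div 2)) = y div 2"
    using Suc.prems by (intro Suc.IH) simp
  ultimately show ?case by (simp add: card_glue lex_down_subset_Pow del: One_nat_def)
qed simp

section \<open>Overlap of the lexicographic segments\<close>

definition overlap :: "nat \<Rightarrow> nat \<Rightarrow> nat \<Rightarrow> nat" where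
  "overlap n x y = card (lex_up n x \<inter> lex_down n y)"

lemma overlap_0: "overlap 0 x y = (if x = 0 \<or> y = 0 then 0 else 1)"
  by (simp add: overlap_def)

lemma overlap_Suc:
  "overlap (Suc n) x y =
    overlap n (x - 2 ^ n) ((y + 1) div 2) + overlap n (min x (2 ^ n)) (y div 2)"
proof -
  have "lex_up n i \<inter> lex_down n j \<subseteq> Pow {1..n}" for i j
    using lex_up_subset_Pow by blast
  then show ?thesis
    by (simp add: overlap_def glue_Int lex_up_subset_Pow lex_down_subset_Pow card_glue
        del: One_nat_def)
qed

lemma finite_lex: "finite (lex_up n x)" "finite (lex_down n y)"
  using lex_up_subset_Pow lex_down_subset_Pow
  by (meson finite_Pow_iff finite_atLeastAtMost finite_subset)+

lemma overlap_mono: "x \<le> x' \<Longrightarrow> y \<le> y' \<Longrightarrow> overlap n x y \<le> overlap n x' y'"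
  unfolding overlap_def
  by (intro card_mono Int_mono lex_up_mono lex_down_mono) (simp_all add: finite_lex)

lemma overlap_le_left: "x \<le> 2 ^ n \<Longrightarrow> overlap n x y \<le> x"
  unfolding overlap_def using card_mono[OF finite_lex(1) Int_lower1] card_lex_up by metis

lemma overlap_0_left [simp]: "overlap n 0 y = 0"
  by (induction n arbitrary: y) (auto simp: overlap_0 overlap_Suc)

lemma overlap_full_left: "y \<le> 2 ^ n \<Longrightarrow> overlap n (2 ^ n) y = y"
proof (induction n arbitrary: y)
  case (Suc n)
  then have "(y + 1) div 2 \<le> 2 ^ n" "y div 2 \<le> 2 ^ n" by auto
  with Suc.IH show ?case by (simp add: overlap_Suc)
qed (auto simp: overlap_0)

lemma overlap_Suc_small: "x \<le> 2 ^ n \<Longrightarrow> overlap (Suc n) x y = overlap n x (y div 2)"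
  by (simp add: overlap_Suc)

lemma overlap_Suc_large:
  assumes "2 ^ n \<le> x" "y \<le> 2 ^ Suc n"
  shows "overlap (Suc n) x y = overlap n (x - 2 ^ n) ((y + 1) div 2) + y div 2"
proof -
  have "y div 2 \<le> 2 ^ n" using assms(2) by simp
  with assms(1) show ?thesis by (simp add: overlap_Suc overlap_full_left)
qed

text \<open>
  Complementing each member turns the complement of a lexicographic segment into the segment of
  complementary size, so the left-hand overlap counts the subsets that lie in neither
  \<open>lex_up n x\<close> nor \<open>lex_down n y\<close>; the identity is inclusion-exclusion. The recursion of
  \<open>overlap\<close> is itself invariant under this reflection, which makes the proof an induction.
\<close>

lemma overlap_complement:
  "x \<le> 2 ^ n \<Longrightarrow> y \<le> 2 ^ n \<Longrightarrow>
    overlap n (2 ^ n - x) (2 ^ n - y) + x + y = 2 ^ n + overlap n x y"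
proof (induction n arbitrary: x y)
  case 0
  then show ?case by (auto simp: overlap_0)
next
  case (Suc n)
  define h :: nat where "h = 2 ^ n"
  define a b c d where "a = x - h" and "b = min x h" and "c = (y + 1) div 2" and "d = y div 2"
  have le: "a \<le> h" "b \<le> h" "c \<le> h" "d \<le> h" and sums: "a + b = x" "c + d = y"
    using Suc.prems by (auto simp: a_def b_def c_def d_def h_def)
  have "2 ^ Suc n - x - h = h - b" "min (2 ^ Suc n - x) h = h - a"
    "(2 ^ Suc n - y + 1) div 2 = h - d" "(2 ^ Suc n - y) div 2 = h - c"
    using Suc.prems by (auto simp: a_def b_def c_def d_def h_def)
  then have "overlap (Suc n) (2 ^ Suc n - x) (2 ^ Suc n - y)
      = overlap n (h - b) (h - d) + overlap n (h - a) (h - c)"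
    by (simp only: overlap_Suc flip: h_def)
  moreover have "overlap (Suc n) x y = overlap n a c + overlap n b d"
    by (simp only: overlap_Suc a_def b_def c_def d_def h_def)
  moreover have "overlap n (h - b) (h - d) + b + d = h + overlap n b d"
    using Suc.IH[of b d] le unfolding h_def by simp
  moreover have "overlap n (h - a) (h - c) + a + c = h + overlap n a c"
    using Suc.IH[of a c] le unfolding h_def by simp
  moreover have "(2::nat) ^ Suc n = h + h" by (simp add: h_def)
  ultimately show ?case using sums by linarith
qed

text \<open>The correlation (Harris-Kleitman) inequality for the lexicographic pair: in the inductive
  step the section sizes of the two families are oppositely ordered, and Chebyshev's sum inequality
  applies.\<close>

lemma overlap_le_product:
  "x \<le> 2 ^ n \<Longrightarrow> y \<le> 2 ^ n \<Longrightarrow> 2 ^ n * overlap n x y \<le> x * y"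
proof (induction n arbitrary: x y)
  case 0
  then show ?case by (auto simp: overlap_0)
next
  case (Suc n)
  define a b c d where "a = x - 2 ^ n" and "b = min x (2 ^ n)"
    and "c = (y + 1) div 2" and "d = y div 2"
  have le: "a \<le> 2 ^ n" "b \<le> 2 ^ n" "c \<le> 2 ^ n" "d \<le> 2 ^ n" and sums: "a + b = x" "c + d = y"
    and ord: "a \<le> b" "d \<le> c"
    using Suc.prems by (auto simp: a_def b_def c_def d_def)
  have "2 ^ Suc n * overlap (Suc n) x y = 2 * (2 ^ n * overlap n a c + 2 ^ n * overlap n b d)"
    by (simp add: overlap_Suc a_def b_def c_def d_def algebra_simps)
  also have "\<dots> \<le> 2 * (a * c + b * d)"
    using Suc.IH[of a c] Suc.IH[of b d] le by simp
  also have "\<dots> \<le> (a + b) * (c + d)"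
  proof -
    obtain i j where "b = a + i" "c = d + j" using ord le_Suc_ex by metis
    then show ?thesis by (simp add: algebra_simps)
  qed
  finally show ?case by (simp add: sums)
qed

section \<open>Superadditivity of the overlap\<close>

text \<open>
  Along the order defining \<open>lex_up\<close>, an initial stretch of \<open>z\<close> subsets meets a fixed \<open>lex_down\<close>
  in no more sets than any other stretch of \<open>z\<close> consecutive subsets.
  In the inductive step let \<open>h\<close> be half of the cube. If \<open>x, z \<le> h < x + z\<close>, the reflection
  \<open>overlap_complement\<close> within one half replaces \<open>x\<close> and \<open>z\<close> by \<open>h - x\<close> and \<open>h - z\<close>, whose sum is
  below \<open>h\<close>; in the other cases the recursion leads directly to the induction hypothesis.
\<close>

lemma overlap_superadd_left:
  "x + z \<le> 2 ^ n \<Longrightarrow> y \<le> 2 ^ n \<Longrightarrow> overlap n x y + overlap n z y \<le> overlap n (x + z) y"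
proof (induction n arbitrary: x z y)
  case 0
  then show ?case by (auto simp: overlap_0)
next
  case (Suc n)
  define h :: nat where "h = 2 ^ n"
  define c d where "c = (y + 1) div 2" and "d = y div 2"
  have cd: "c \<le> h" "d \<le> h" "d \<le> c"
    using Suc.prems by (auto simp: c_def d_def h_def)
  have small: "overlap (Suc n) t y = overlap n t d" if "t \<le> h" for t
    using that by (simp add: overlap_Suc_small h_def d_def)
  have large: "overlap (Suc n) t y = overlap n (t - h) c + d" if "h \<le> t" for t
    using that Suc.prems(2) by (simp add: overlap_Suc_large h_def d_def c_def)
  have IH: "overlap n t i + overlap n u i \<le> overlap n (t + u) i" if "t + u \<le> h" "i \<le> h" for t u i
    using Suc.IH that by (simp add: h_def)
  have one_large: "overlap (Suc n) t y + overlap (Suc n) u y \<le> overlap (Suc n) (t + u) y"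
    if "h \<le> t" "t + u \<le> 2 * h" for t u
  proof -
    have "overlap n (t - h) c + overlap n u d \<le> overlap n (t - h) c + overlap n u c"
      using cd by (simp add: overlap_mono)
    also have "\<dots> \<le> overlap n (t + u - h) c"
      using IH[of "t - h" u c] that cd by (simp add: Nat.add_diff_assoc2 add.commute)
    finally show ?thesis using that small[of u] large[of t] large[of "t + u"] by simp
  qed
  have xz: "x + z \<le> 2 * h" using Suc.prems(1) by (simp add: h_def)
  consider "x + z \<le> h" | "h \<le> x" | "h \<le> z" | "x < h" "z < h" "h < x + z" by linarith
  then show ?case
  proof cases
    case 1
    then show ?thesis using IH[of x z d] cd small by simp
  next
    case 2
    with one_large xz show ?thesis by simp
  next
    case 3
    with one_large[of z x] xz show ?thesis by (simp add: add.commute)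
  next
    case 4
    define w where "w = x + z - h"
    have w: "h - w = (h - x) + (h - z)" "w \<le> h" using 4 by (auto simp: w_def)
    have compl: "overlap n (h - t) (h - d) + t + d = h + overlap n t d" if "t \<le> h" for t
      using overlap_complement[of t n d] that cd by (simp add: h_def)
    have "overlap n (h - x) (h - d) + overlap n (h - z) (h - d) \<le> overlap n (h - w) (h - d)"
      unfolding w(1) by (rule IH) (use 4 in auto)
    moreover have "w + h = x + z" using 4 by (simp add: w_def)
    ultimately have "overlap n x d + overlap n z d \<le> overlap n w d + d"
      using compl[of x] compl[of z] compl[of w] 4 w(2) by linarith
    also have "\<dots> \<le> overlap n w c + d" using cd by (simp add: overlap_mono)
    finally show ?thesis using 4 small large[of "x + z"] by (simp add: w_def)
  qed
qed

text \<open>The reflection \<open>overlap_complement\<close> maps the instances with \<open>x0 + x1 \<ge> 2^n\<close> to those with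
  \<open>x0 + x1 \<le> 2^n\<close>. The reduction is kept separate because the induction below proves only the
  latter but needs both as its hypothesis.\<close>

lemma superadd_all_if_superadd_half:
  assumes half: "\<And>x0 x1 y0 y1. x0 \<le> x1 \<Longrightarrow> x0 + x1 \<le> 2 ^ n \<Longrightarrow> y1 \<le> y0 \<Longrightarrow> y0 \<le> 2 ^ n \<Longrightarrow>
      overlap n x0 y0 + overlap n x1 y1 \<le> overlap (Suc n) (x0 + x1) (y0 + y1)"
    and le: "x0 \<le> x1" "x1 \<le> 2 ^ n" "y1 \<le> y0" "y0 \<le> 2 ^ n"
  shows "overlap n x0 y0 + overlap n x1 y1 \<le> overlap (Suc n) (x0 + x1) (y0 + y1)"
proof (cases "x0 + x1 \<le> 2 ^ n")
  case True
  with half le show ?thesis by simp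
next
  case False
  let ?N = "2 ^ n :: nat"
  have "overlap n (?N - x1) (?N - y1) + overlap n (?N - x0) (?N - y0)
      \<le> overlap (Suc n) ((?N - x1) + (?N - x0)) ((?N - y1) + (?N - y0))"
    by (rule half) (use le False in auto)
  moreover have "(?N - x1) + (?N - x0) = 2 ^ Suc n - (x0 + x1)"
    "(?N - y1) + (?N - y0) = 2 ^ Suc n - (y0 + y1)"
    using le by auto
  ultimately have "overlap n (?N - x1) (?N - y1) + overlap n (?N - x0) (?N - y0)
      \<le> overlap (Suc n) (2 ^ Suc n - (x0 + x1)) (2 ^ Suc n - (y0 + y1))"
    by simp
  moreover have "overlap n (?N - x1) (?N - y1) + x1 + y1 = ?N + overlap n x1 y1"
    using le by (intro overlap_complement) auto
  moreover have "overlap n (?N - x0) (?N - y0) + x0 + y0 = ?N + overlap n x0 y0"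
    using le by (intro overlap_complement) auto
  moreover have "overlap (Suc n) (2 ^ Suc n - (x0 + x1)) (2 ^ Suc n - (y0 + y1))
      + (x0 + x1) + (y0 + y1) = 2 ^ Suc n + overlap (Suc n) (x0 + x1) (y0 + y1)"
    using le by (intro overlap_complement) auto
  ultimately show ?thesis by simp
qed

text \<open>
  Write \<open>h\<close> for half of the cube. If \<open>x1 \<le> h\<close>, both overlaps live in the half containing the most
  significant element, and the induction hypothesis applies to the pairs with halved \<open>y\<close>. If
  \<open>x1 > h\<close>, then moving the excess \<open>d = x1 - h\<close> from \<open>x1\<close> to \<open>x0\<close> does not decrease the sum of the
  two overlaps: the excess contributes \<open>overlap n d ((y1 + 1) div 2)\<close> to the second, and by
  \<open>overlap_superadd_left\<close> at least \<open>overlap n d (y0 div 2)\<close> to the first, where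
  \<open>(y1 + 1) div 2 \<le> y0 div 2\<close> unless \<open>y0 = y1\<close>. After the move the first case applies.
\<close>

lemma overlap_superadd_half:
  "x0 \<le> x1 \<Longrightarrow> x0 + x1 \<le> 2 ^ n \<Longrightarrow> y1 \<le> y0 \<Longrightarrow> y0 \<le> 2 ^ n \<Longrightarrow>
    overlap n x0 y0 + overlap n x1 y1 \<le> overlap (Suc n) (x0 + x1) (y0 + y1)"
proof (induction n arbitrary: x0 x1 y0 y1)
  case 0
  then have "x0 = 0" by simp
  moreover have "y1 \<le> (y0 + y1) div 2" using 0 by simp
  ultimately show ?case using 0 by (simp add: overlap_Suc_small overlap_mono)
next
  case (Suc n)
  define h :: nat where "h = 2 ^ n"
  define X Y where "X = x0 + x1" and "Y = y0 + y1"
  have X: "X \<le> 2 * h" using Suc.prems by (simp add: X_def h_def)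
  have small: "overlap (Suc n) t i = overlap n t (i div 2)" if "t \<le> h" for t i
    using that by (simp add: overlap_Suc_small h_def)
  have target: "overlap (Suc (Suc n)) X Y = overlap (Suc n) X (Y div 2)"
    using X by (simp add: overlap_Suc_small h_def)
  \<comment> \<open>Stated for arbitrary parts of \<open>X\<close>, so that it also applies after the excess has been moved.\<close>
  have both_small: "overlap (Suc n) s0 y0 + overlap (Suc n) s1 y1 \<le> overlap (Suc n) X (Y div 2)"
    if s: "s0 \<le> s1" "s1 \<le> h" "s0 + s1 = X" for s0 s1
  proof -
    have "overlap n s0 (y0 div 2) + overlap n s1 (y1 div 2)
        \<le> overlap (Suc n) (s0 + s1) (y0 div 2 + y1 div 2)"
      by (rule superadd_all_if_superadd_half[OF Suc.IH]) (use s Suc.prems in \<open>auto simp: h_def\<close>)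
    also have "\<dots> \<le> overlap (Suc n) X (Y div 2)"
      unfolding s(3) by (intro overlap_mono) (auto simp: Y_def)
    finally show ?thesis using s small by simp
  qed
  have "overlap (Suc n) x0 y0 + overlap (Suc n) x1 y1 \<le> overlap (Suc n) X (Y div 2)"
  proof (cases "x1 \<le> h")
    case True
    with both_small Suc.prems show ?thesis by (simp add: X_def)
  next
    case False
    show ?thesis
    proof (cases "y0 = y1")
      case True
      then have "Y div 2 = y0" by (simp add: Y_def)
      with True Suc.prems show ?thesis by (simp add: X_def overlap_superadd_left)
    next
      case neq: False
      define d where "d = x1 - h"
      have d: "x1 = h + d" "x0 + d \<le> h" using False X by (auto simp: d_def X_def)
      have le: "(y1 + 1) div 2 \<le> y0 div 2" using Suc.prems neq by simp
      have y0: "y0 div 2 \<le> h" using Suc.prems by (simp add: h_def)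
      have "overlap (Suc n) x0 y0 + overlap (Suc n) x1 y1
          = overlap n x0 (y0 div 2) + overlap n d ((y1 + 1) div 2) + y1 div 2"
        using d Suc.prems overlap_Suc_large[of n x1 y1] small[of x0 y0] by (simp add: h_def)
      also have "\<dots> \<le> overlap n x0 (y0 div 2) + overlap n d (y0 div 2) + y1 div 2"
        using le by (simp add: overlap_mono)
      also have "\<dots> \<le> overlap n (x0 + d) (y0 div 2) + y1 div 2"
        using d y0 by (simp add: overlap_superadd_left h_def)
      also have "\<dots> = overlap (Suc n) (x0 + d) y0 + overlap (Suc n) h y1"
        using d Suc.prems small[of "x0 + d" y0] overlap_Suc_large[of n h y1] by (simp add: h_def)
      also have "\<dots> \<le> overlap (Suc n) X (Y div 2)"
        using d by (intro both_small) (auto simp: X_def)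
      finally show ?thesis .
    qed
  qed
  with target show ?case by (simp add: X_def Y_def)
qed

lemma overlap_superadd:
  assumes "x0 \<le> x1" "x1 \<le> 2 ^ n" "y1 \<le> y0" "y0 \<le> 2 ^ n"
  shows "overlap n x0 y0 + overlap n x1 y1 \<le> overlap (Suc n) (x0 + x1) (y0 + y1)"
  using superadd_all_if_superadd_half[OF overlap_superadd_half] assms by blast

section \<open>Symmetry, trimming and optimality\<close>

text \<open>The mirror image of \<open>overlap_Suc_small\<close>: the roles of the two families are interchanged
  by reversing the order of the coordinates and complementing every set.\<close>

lemma overlap_Suc_small_right:
  "x \<le> 2 ^ Suc n \<Longrightarrow> y \<le> 2 ^ n \<Longrightarrow> overlap (Suc n) x y = overlap n (x div 2) y"
proof (induction n arbitrary: x y)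
  case 0
  then have "x = 0 \<or> x = 1 \<or> x = 2" "y = 0 \<or> y = 1" by auto
  then show ?case by (auto simp: overlap_Suc overlap_0)
next
  case (Suc n)
  let ?c = "(y + 1) div 2" and ?d = "y div 2"
  have "overlap (Suc (Suc n)) x y
      = overlap (Suc n) (x - 2 ^ Suc n) ?c + overlap (Suc n) (min x (2 ^ Suc n)) ?d"
    by (rule overlap_Suc)
  also have "\<dots> = overlap n ((x - 2 ^ Suc n) div 2) ?c + overlap n (min x (2 ^ Suc n) div 2) ?d"
    using Suc.prems by (simp add: Suc.IH)
  also have "(x - 2 ^ Suc n) div 2 = x div 2 - 2 ^ n" by simp
  also have "min x (2 ^ Suc n) div 2 = min (x div 2) (2 ^ n)" by (auto simp: min_def)
  finally show ?case by (simp add: overlap_Suc)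
qed

lemma overlap_Suc_left_le: "overlap n (Suc x) y \<le> overlap n x y + 1" if "Suc x \<le> 2 ^ n"
proof -
  let ?D = "lex_up n (Suc x) - lex_up n x"
  have "card ?D = 1"
    using that lex_up_mono[of x "Suc x" n]
    by (simp add: card_Diff_subset finite_lex card_lex_up)
  have "lex_up n (Suc x) \<inter> lex_down n y \<subseteq> (lex_up n x \<inter> lex_down n y) \<union> ?D" by blast
  then have "overlap n (Suc x) y \<le> card ((lex_up n x \<inter> lex_down n y) \<union> ?D)"
    unfolding overlap_def by (intro card_mono) (auto simp: finite_lex)
  also have "\<dots> \<le> overlap n x y + card ?D"
    unfolding overlap_def by (rule card_Un_le)
  finally show ?thesis using \<open>card ?D = 1\<close> by simp
qed

text \<open>Shrinking \<open>x\<close> one step at a time lowers the overlap by at most one per step, so the overlap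
  can be brought down to exactly \<open>m\<close> without increasing \<open>x + y - overlap n x y\<close>.\<close>

lemma overlap_trim:
  "x \<le> 2 ^ n \<Longrightarrow> m \<le> overlap n x y \<Longrightarrow>
    \<exists>x'\<le>x. overlap n x' y = m \<and> x' + overlap n x y \<le> x + m"
proof (induction x)
  case 0
  then show ?case by auto
next
  case (Suc x)
  show ?case
  proof (cases "overlap n (Suc x) y = m")
    case True
    then show ?thesis by blast
  next
    case False
    have step: "overlap n (Suc x) y \<le> overlap n x y + 1"
      using Suc.prems by (intro overlap_Suc_left_le)
    with False Suc.prems have "m \<le> overlap n x y" by simp
    with Suc obtain x' where "x' \<le> x" "overlap n x' y = m" "x' + overlap n x y \<le> x + m"
      by auto
    with step show ?thesis by (intro exI[of _ x']) auto
  qed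
qed

text \<open>The sections of an up-set increase and those of a down-set decrease with the last element;
  these are exactly the order hypotheses of \<open>overlap_superadd\<close>.\<close>

lemma card_up_Int_down_le_overlap:
  "up_set n U \<Longrightarrow> down_set n D \<Longrightarrow> card (U \<inter> D) \<le> overlap n (card U) (card D)"
proof (induction n arbitrary: U D)
  case 0
  then have "U = {} \<or> U = {{}}" "D = {} \<or> D = {{}}"
    by (auto simp: up_set_def down_set_def)
  then show ?case by (auto simp: overlap_0)
next
  case (Suc n)
  obtain U0 U1 where U: "up_set n U0" "up_set n U1" "U0 \<subseteq> U1" "U = glue n U0 U1"
    using up_set_sections[OF Suc.prems(1)] by blast
  obtain D0 D1 where D: "down_set n D0" "down_set n D1" "D1 \<subseteq> D0" "D = glue n D0 D1"
    using down_set_sections[OF Suc.prems(2)] by blast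
  have sub: "U0 \<subseteq> Pow {1..n}" "U1 \<subseteq> Pow {1..n}" "D0 \<subseteq> Pow {1..n}" "D1 \<subseteq> Pow {1..n}"
    using U D by (auto simp: up_set_def down_set_def)
  have fin: "finite U1" "finite D0"
    using sub by (meson finite_Pow_iff finite_atLeastAtMost finite_subset)+
  have Pow: "card A \<le> 2 ^ n" if "A \<subseteq> Pow {1..n}" for A
    using card_mono[OF _ that] by (simp add: card_Pow)
  have int: "U0 \<inter> D0 \<subseteq> Pow {1..n}" "U1 \<inter> D1 \<subseteq> Pow {1..n}" using sub by auto
  have "card (U \<inter> D) = card (U0 \<inter> D0) + card (U1 \<inter> D1)"
    using int by (simp add: U D glue_Int sub card_glue del: One_nat_def)
  also have "\<dots> \<le> overlap n (card U0) (card D0) + overlap n (card U1) (card D1)"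
    using Suc.IH U D by (simp add: add_mono)
  also have "\<dots> \<le> overlap (Suc n) (card U0 + card U1) (card D0 + card D1)"
    using U D fin sub by (intro overlap_superadd card_mono Pow) auto
  also have "\<dots> = overlap (Suc n) (card U) (card D)"
    by (simp add: U D card_glue sub del: One_nat_def)
  finally show ?case .
qed

section \<open>The minimum in terms of the overlap function\<close>

lemma up_set_up_closure: "up_set n (up_closure n F)"
  unfolding up_set_def up_closure_def by blast

lemma down_set_down_closure: "down_set n (down_closure n F)"
  unfolding down_set_def down_closure_def by blast

lemma Phi_le_iff_family:
  assumes "m \<le> 2 ^ n"
  shows "Phi n m \<le> k \<longleftrightarrow> (\<exists>F \<subseteq> Pow {1..n}. card F = m \<and> card (updown_closure n F) \<le> k)"
proof -
  let ?A = "{card (updown_closure n F) |F. F \<subseteq> Pow {1..n} \<and> card F = m}"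
  have "?A \<subseteq> (\<lambda>F. card (updown_closure n F)) ` Pow (Pow {1..n})" by blast
  then have fin: "finite ?A" by (rule finite_subset) simp
  have "m \<le> card (Pow {1..n})" using assms by (simp add: card_Pow)
  then obtain F where "F \<subseteq> Pow {1..n}" "card F = m"
    using obtain_subset_with_card_n by metis
  then have "?A \<noteq> {}" by blast
  with fin show ?thesis unfolding Phi_def by (subst Min_le_iff) auto
qed

text \<open>Here \<open>x\<close> and \<open>y\<close> are the sizes of an up-set and a down-set: the closures of a given family
  in one direction, the lexicographic segments in the other.\<close>

lemma Phi_le_iff:
  assumes m: "m \<le> 2 ^ n"
  shows "Phi n m \<le> k \<longleftrightarrow>
    (\<exists>x\<le>2 ^ n. \<exists>y\<le>2 ^ n. m \<le> overlap n x y \<and> x + y \<le> overlap n x y + k)"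
  unfolding Phi_le_iff_family[OF m]
proof
  assume "\<exists>F \<subseteq> Pow {1..n}. card F = m \<and> card (updown_closure n F) \<le> k"
  then obtain F where F: "F \<subseteq> Pow {1..n}" "card F = m" "card (updown_closure n F) \<le> k" by blast
  define U D where "U = up_closure n F" and "D = down_closure n F"
  have UD: "up_set n U" "down_set n D"
    by (simp_all add: U_def D_def up_set_up_closure down_set_down_closure)
  then have sub: "U \<subseteq> Pow {1..n}" "D \<subseteq> Pow {1..n}" by (auto simp: up_set_def down_set_def)
  then have fin: "finite U" "finite D"
    by (meson finite_Pow_iff finite_atLeastAtMost finite_subset)+
  have "card U \<le> 2 ^ n" "card D \<le> 2 ^ n"
    using sub[THEN card_mono[rotated]] by (simp_all add: card_Pow)
  moreover have "F \<subseteq> U \<inter> D"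
    using F(1) unfolding U_def D_def up_closure_def down_closure_def by blast
  then have "m \<le> card (U \<inter> D)" using F(2) fin card_mono by blast
  moreover have "card U + card D \<le> card (U \<inter> D) + k"
    using card_Un_Int[OF fin] F(3) by (simp add: updown_closure_def U_def D_def)
  ultimately show "\<exists>x\<le>2 ^ n. \<exists>y\<le>2 ^ n. m \<le> overlap n x y \<and> x + y \<le> overlap n x y + k"
    using card_up_Int_down_le_overlap[OF UD] 
    by (intro exI[of _ "card U"] exI[of _ "card D"] conjI) linarith+
next
  assume "\<exists>x\<le>2 ^ n. \<exists>y\<le>2 ^ n. m \<le> overlap n x y \<and> x + y \<le> overlap n x y + k"
  then obtain x y where xy: "x \<le> 2 ^ n" "y \<le> 2 ^ n" "m \<le> overlap n x y" "x + y \<le> overlap n x y + k"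
    by blast
  define U D where "U = lex_up n x" and "D = lex_down n y"
  have UD: "up_set n U" "down_set n D"
    using xy by (simp_all add: U_def D_def up_set_lex_up down_set_lex_down)
  obtain F where F: "F \<subseteq> U \<inter> D" "card F = m"
    using xy(3) obtain_subset_with_card_n unfolding overlap_def U_def D_def by metis
  have "up_closure n F \<subseteq> U" "down_closure n F \<subseteq> D"
    using F(1) UD by (auto simp: up_closure_def down_closure_def up_set_def down_set_def)
  then have "updown_closure n F \<subseteq> U \<union> D" unfolding updown_closure_def by blast
  then have "card (updown_closure n F) \<le> card (U \<union> D)"
    by (intro card_mono) (simp_all add: U_def D_def finite_lex)
  moreover have "card (U \<union> D) + overlap n x y = x + y"
    using card_Un_Int[of U D] xy
    by (simp add: U_def D_def overlap_def finite_lex card_lex_up card_lex_down)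
  moreover have "F \<subseteq> Pow {1..n}" using F(1) UD by (auto simp: up_set_def)
  ultimately show "\<exists>F \<subseteq> Pow {1..n}. card F = m \<and> card (updown_closure n F) \<le> k"
    using F(2) xy(4) by (intro exI[of _ F]) auto
qed

lemma Phi_attained:
  assumes "m \<le> 2 ^ n"
  obtains x y where "x \<le> 2 ^ n" "y \<le> 2 ^ n" "overlap n x y = m" "x + y \<le> m + Phi n m"
proof -
  obtain x y where xy: "x \<le> 2 ^ n" "y \<le> 2 ^ n" "m \<le> overlap n x y"
    "x + y \<le> overlap n x y + Phi n m"
    using Phi_le_iff[OF assms, of "Phi n m"] by blast
  obtain x' where "x' \<le> x" "overlap n x' y = m" "x' + overlap n x y \<le> x + m"
    using overlap_trim[OF xy(1,3)] by blast
  with xy show ?thesis by (intro that[of x' y]) auto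
qed

text \<open>Replacing the two families by their complements, that is, \<open>x\<close> and \<open>y\<close> by \<open>2^n - x\<close> and
  \<open>2^n - y\<close>.\<close>

lemma Phi_le_dual:
  assumes "m \<le> 2 ^ n" "k \<le> 2 ^ n" "Phi n m \<le> k"
  shows "Phi n (2 ^ n - k) \<le> 2 ^ n - m"
proof -
  obtain x y where xy: "x \<le> 2 ^ n" "y \<le> 2 ^ n" "m \<le> overlap n x y" "x + y \<le> overlap n x y + k"
    using Phi_le_iff[OF assms(1)] assms(3) by blast
  have compl: "overlap n (2 ^ n - x) (2 ^ n - y) + x + y = 2 ^ n + overlap n x y"
    using xy by (intro overlap_complement)
  show ?thesis
    using xy compl assms unfolding Phi_le_iff[of "2 ^ n - k" n, OF diff_le_self]
    by (intro exI[of _ "2 ^ n - x"] exI[of _ "2 ^ n - y"] conjI) simp_all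
qed

lemma Phi_le_full:
  assumes "m \<le> 2 ^ n"
  shows "Phi n m \<le> 2 ^ n"
  unfolding Phi_le_iff[OF assms]
  by (rule exI[of _ "2 ^ n"], simp, rule exI[of _ "2 ^ n"]) (simp add: overlap_full_left assms)

lemma Phi_0_right [simp]: "Phi n 0 = 0"
proof -
  have "Phi n 0 \<le> 0"
    by (subst Phi_le_iff) (simp, intro exI[of _ 0], simp)
  then show ?thesis by simp
qed

section \<open>The recursion for small and large families\<close>

text \<open>By \<open>overlap_le_product\<close> and the inequality of the arithmetic and geometric mean.\<close>

lemma overlap_le_quarter:
  assumes "x \<le> 2 ^ Suc (Suc k)" "y \<le> 2 ^ Suc (Suc k)" "x + y \<le> 2 ^ Suc (Suc k)"
  shows "overlap (Suc (Suc k)) x y \<le> 2 ^ k"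
proof -
  let ?q = "2 ^ k :: nat"
  have "16 * (?q * overlap (Suc (Suc k)) x y) = 4 * (2 ^ Suc (Suc k) * overlap (Suc (Suc k)) x y)"
    by simp
  also have "\<dots> \<le> 4 * (x * y)"
    using overlap_le_product[OF assms(1,2)] by simp
  also have "\<dots> \<le> (x + y) * (x + y)"
  proof -
    have "int (4 * (x * y)) \<le> int ((x + y) * (x + y))"
      using zero_le_square[of "int x - int y"] by (simp add: algebra_simps)
    then show ?thesis by (simp only: of_nat_le_iff)
  qed
  also have "\<dots> \<le> (4 * ?q) * (4 * ?q)" using assms(3) by (intro mult_le_mono) simp_all
  also have "\<dots> = 16 * (?q * ?q)" by simp
  finally have "?q * overlap (Suc (Suc k)) x y \<le> ?q * ?q" by linarith
  then show ?thesis by (simp only: mult_le_cancel1) simp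
qed

text \<open>
  If \<open>x + y\<close> is at most \<open>2^n\<close>, then the overlap is at most a quarter of the cube; otherwise this
  holds for the reflected pair, whose overlap is at least \<open>m\<close>. The second case contradicts the
  size of \<open>m\<close>.
\<close>

lemma Phi_large_imp_small:
  assumes "m \<le> 2 ^ Suc (Suc k)" "2 ^ k < m" "s \<le> 2 ^ Suc (Suc k)"
    and Phi: "Phi (Suc (Suc k)) s \<le> 2 ^ Suc (Suc k) - m"
  shows "s \<le> 2 ^ k"
proof -
  let ?n = "Suc (Suc k)" and ?N = "2 ^ Suc (Suc k) :: nat"
  obtain x y where xy: "x \<le> ?N" "y \<le> ?N" "s \<le> overlap ?n x y" "x + y \<le> overlap ?n x y + (?N - m)"
    using Phi Phi_le_iff[OF assms(3)] by blast
  have compl: "overlap ?n (?N - x) (?N - y) + x + y = ?N + overlap ?n x y"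
    using xy by (intro overlap_complement)
  show ?thesis
  proof (cases "x + y \<le> ?N")
    case True
    with overlap_le_quarter[OF xy(1,2)] xy(3) show ?thesis by simp
  next
    case False
    then have "overlap ?n (?N - x) (?N - y) \<le> 2 ^ k"
      using xy by (intro overlap_le_quarter) simp_all
    with compl xy(4) assms(1,2) show ?thesis by linarith
  qed
qed

lemma overlap_halve:
  assumes "x \<le> 2 ^ Suc k" "y \<le> 2 ^ Suc k"
  shows "overlap (Suc (Suc k)) x y = overlap k (x div 2) (y div 2)"
proof -
  have "overlap (Suc (Suc k)) x y = overlap (Suc k) x (y div 2)"
    using assms(1) by (rule overlap_Suc_small)
  also have "\<dots> = overlap k (x div 2) (y div 2)"
    using assms by (intro overlap_Suc_small_right) simp_all
  finally show ?thesis .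
qed

text \<open>From \<open>(x - h) (y - h) \<le> 0\<close> one gets \<open>x y \<le> h (x + y - h)\<close>, and the correlation bound
  finishes. The constants are best possible: equality holds when \<open>x = h\<close> and \<open>y\<close> is even.\<close>

lemma overlap_le_if_unbalanced:
  assumes "h \<le> x \<and> y \<le> h \<or> x \<le> h \<and> h \<le> y" "2 * h = 2 ^ n" "x \<le> 2 ^ n" "y \<le> 2 ^ n"
  shows "2 * overlap n x y + h \<le> x + y"
proof -
  have "h > 0" using assms(2) by (cases h) auto
  have cross: "x * y + h * h \<le> h * (x + y)"
  proof -
    have "(int x - int h) * (int y - int h) \<le> 0"
      using assms(1) by (auto simp: mult_le_0_iff)
    then have "int (x * y + h * h) \<le> int (h * (x + y))" by (simp add: algebra_simps)
    then show ?thesis by (simp only: of_nat_le_iff)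
  qed
  have "h * (2 * overlap n x y + h) = 2 ^ n * overlap n x y + h * h"
    by (simp add: algebra_simps flip: assms(2))
  also have "\<dots> \<le> x * y + h * h" using overlap_le_product[OF assms(3,4)] by simp
  also note cross
  finally show ?thesis using \<open>h > 0\<close> by simp
qed

text \<open>
  If both sizes are at most half of the cube, halving them works directly. Otherwise the sizes are
  so large that the pair consisting of the full power set and a down-set of \<open>overlap\<close> many
  members is already small enough.
\<close>

lemma halve_dimensions:
  assumes "x \<le> 2 ^ Suc (Suc k)" "y \<le> 2 ^ Suc (Suc k)"
    and "overlap (Suc (Suc k)) x y \<le> 2 ^ k"
  shows "\<exists>x'\<le>2 ^ k. \<exists>y'\<le>2 ^ k. overlap (Suc (Suc k)) x y \<le> overlap k x' y' \<and> 2 * (x' + y') \<le> x + y"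
proof -
  let ?m = "overlap (Suc (Suc k)) x y" and ?h = "2 ^ Suc k :: nat"
  show ?thesis
  proof (cases "x \<le> ?h \<and> y \<le> ?h")
    case True
    then have "?m = overlap k (x div 2) (y div 2)" using overlap_halve by simp
    with True show ?thesis by (intro exI[of _ "x div 2"] exI[of _ "y div 2"] conjI) auto
  next
    case False
    have "2 * ?m + ?h \<le> x + y"
    proof -
      consider "?h \<le> x \<and> y \<le> ?h \<or> x \<le> ?h \<and> ?h \<le> y" | "?h \<le> x" "?h \<le> y"
        using False by linarith
      then show ?thesis
      proof cases
        case 1
        then show ?thesis using assms by (intro overlap_le_if_unbalanced) simp_all
      next
        case 2
        then show ?thesis using assms by simp
      qed
    qed
    moreover have "overlap k (2 ^ k) ?m = ?m" using assms by (intro overlap_full_left)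
    ultimately show ?thesis using assms
      by (intro exI[of _ "2 ^ k"] exI[of _ ?m] conjI) auto
  qed
qed

text \<open>Doubling the sizes of an optimal pair on \<open>k\<close> coordinates preserves the overlap, by
  \<open>overlap_halve\<close>; \<open>halve_dimensions\<close> goes back. The summand \<open>m\<close> arises because the sizes are
  doubled while the intersection to be subtracted from their sum stays the same.\<close>

lemma Phi_small:
  assumes m: "m \<le> 2 ^ k"
  shows "Phi (Suc (Suc k)) m = 2 * Phi k m + m"
proof (rule antisym)
  let ?n = "Suc (Suc k)"
  have m': "m \<le> 2 ^ ?n" using m by simp
  obtain x y where xy: "x \<le> 2 ^ k" "y \<le> 2 ^ k" "overlap k x y = m" "x + y \<le> m + Phi k m"
    using Phi_attained[OF m] by blast
  then have "overlap ?n (2 * x) (2 * y) = m" by (simp add: overlap_halve)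
  with xy show "Phi ?n m \<le> 2 * Phi k m + m"
    unfolding Phi_le_iff[OF m'] by (intro exI[of _ "2 * x"] exI[of _ "2 * y"] conjI) simp_all
  obtain u v where uv: "u \<le> 2 ^ ?n" "v \<le> 2 ^ ?n" "overlap ?n u v = m" "u + v \<le> m + Phi ?n m"
    using Phi_attained[OF m'] by blast
  obtain u' v' where uv': "u' \<le> 2 ^ k" "v' \<le> 2 ^ k" "m \<le> overlap k u' v'" "2 * (u' + v') \<le> u + v"
    using halve_dimensions[OF uv(1,2)] uv(3) m by auto
  have "Phi k m \<le> u' + v' - overlap k u' v'"
    unfolding Phi_le_iff[OF m] using uv' by (intro exI[of _ u'] exI[of _ v'] conjI) simp_all
  moreover have "overlap k u' v' \<le> u'" using uv'(1) by (rule overlap_le_left)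
  ultimately have "Phi k m + m \<le> u' + v'" using uv'(3) by simp
  then have "2 * (Phi k m + m) \<le> 2 * (u' + v')" by simp
  also note uv'(4)
  also note uv(4)
  finally have "2 * (Phi k m + m) \<le> m + Phi ?n m" .
  then show "2 * Phi k m + m \<le> Phi ?n m" by simp
qed

text \<open>By \<open>Phi_le_dual\<close>, the least \<open>b\<close> with \<open>Phi n m \<le> b\<close> corresponds to the greatest \<open>s = 2^n - b\<close>
  with \<open>Phi n s \<le> 2^n - m\<close>, and \<open>Phi_large_imp_small\<close> confines that \<open>s\<close> to the range of the
  maximum.\<close>

lemma Phi_large:
  assumes "2 ^ k < m" "m \<le> 2 ^ Suc (Suc k)"
  shows "Phi (Suc (Suc k)) m =
    2 ^ Suc (Suc k) - Max {s \<in> {0..2 ^ k}. Phi (Suc (Suc k)) s \<le> 2 ^ Suc (Suc k) - m}"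
proof -
  let ?n = "Suc (Suc k)" and ?N = "2 ^ Suc (Suc k) :: nat"
  let ?S = "{s \<in> {0..2 ^ k}. Phi ?n s \<le> ?N - m}"
  define M where "M = Max ?S"
  have "0 \<in> ?S" by simp
  then have M: "M \<in> ?S" unfolding M_def by (intro Max_in) auto
  then have MN: "M \<le> ?N" by simp
  have "Phi ?n (?N - (?N - m)) \<le> ?N - M"
    using M MN by (intro Phi_le_dual) simp_all
  then have upper: "Phi ?n m \<le> ?N - M" using assms(2) by simp
  have "Phi ?n m \<le> ?N" using assms(2) by (rule Phi_le_full)
  moreover from this have dual: "Phi ?n (?N - Phi ?n m) \<le> ?N - m"
    using assms(2) by (intro Phi_le_dual) simp_all
  moreover have "?N - Phi ?n m \<le> 2 ^ k"
    using Phi_large_imp_small[OF assms(2,1) _ dual] by simp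
  ultimately have "?N - Phi ?n m \<le> M" unfolding M_def by (intro Max_ge) auto
  with upper \<open>Phi ?n m \<le> ?N\<close> MN show ?thesis unfolding M_def by linarith
qed

theorem theorem1p1:
  shows "(Phi 0 0, Phi 0 1) = (0, 1) \<and>
    (Phi 1 0, Phi 1 1, Phi 1 2) = (0, 2, 2) \<and>
    (\<forall>n m :: nat. n \<ge> 2 \<longrightarrow> m \<in> {0..2 ^ n} \<longrightarrow>
      Phi n m =
        (if m \<in> {0..2 ^ (n - 2)} then 2 * Phi (n - 2) m + m
         else 2 ^ n - Max {s \<in> {0..2 ^ (n - 2)}. Phi n s \<le> 2 ^ n - m}))"
proof (intro conjI allI impI)
  have "\<not> Phi 0 1 \<le> 0"
    by (subst Phi_le_iff) (auto simp: overlap_0 split: if_splits)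
  moreover have "Phi 0 1 \<le> 1" using Phi_le_full[of 1 0] by simp
  ultimately show "(Phi 0 0, Phi 0 1) = (0, 1)" by simp
next
  have lower: "\<not> Phi 1 m \<le> 1" if "m = 1 \<or> m = 2" for m
  proof -
    have "x = 0 \<or> x = 1 \<or> x = 2" if "x \<le> 2" for x :: nat using that by auto
    then show ?thesis using that
      by (subst Phi_le_iff) (auto simp: overlap_0 overlap_Suc split: if_splits)
  qed
  have "Phi 1 m = 2" if "m = 1 \<or> m = 2" for m
    using lower[OF that] Phi_le_full[of m 1] that by auto
  then show "(Phi 1 0, Phi 1 1, Phi 1 2) = (0, 2, 2)" by simp
next
  fix n m :: nat
  assume "n \<ge> 2" and m: "m \<in> {0..2 ^ n}"
  then obtain k where n: "n = Suc (Suc k)" using le_Suc_ex[of 2 n] by auto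
  show "Phi n m =
        (if m \<in> {0..2 ^ (n - 2)} then 2 * Phi (n - 2) m + m
         else 2 ^ n - Max {s \<in> {0..2 ^ (n - 2)}. Phi n s \<le> 2 ^ n - m})"
  proof (cases "m \<le> 2 ^ k")
    case True
    with Phi_small[OF True] show ?thesis by (simp add: n)
  next
    case False
    then have "2 ^ k < m" "m \<le> 2 ^ Suc (Suc k)" using m by (simp_all add: n)
    from Phi_large[OF this] False show ?thesis by (simp add: n)
  qed
qed

end
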